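(* The lamplighter group $G = \mathbb{Z}_2 \wr \mathbb{Z}$ has periodic asymptotic dimension $\mathrm{pdim}(G) = 1$.
   Context: $\mathbb{Z}_2 = \mathbb{Z}/2\mathbb{Z}$ and $\mathbb{Z}_2 \wr \mathbb{Z} = \left(\bigoplus_{\mathbb{Z}} \mathbb{Z}_2\right) \rtimes \mathbb{Z}$ is the restricted wreath product, with $\mathbb{Z}$ acting by shifting coordinates. Periodic asymptotic dimension: let $G$ be a finitely generated group with a fixed finite symmetric generating set and word norm $|\cdot|$. $G$ acts on $\{1,\ldots,n\}^G$ by $(gx)_h = x_{g^{-1}h}$, and a configuration $x$ is periodic if its stabilizer has finite index in $G$. For $n, r, m \in \mathbb{N}$ let $X_{n,r,m} \subset \{1,\ldots,n\}^G$ be the set of $x$ such that for each color $c \in \{1,\ldots,n\}$, the graph with vertex set $\{a \in G : x_a = c\}$ and edges $\{(a,b) : x_a = x_b = c,\ |a^{-1}b| \leq r\}$ has all connected components of cardinality at most $m$. The periodic asymptotic dimension $\mathrm{pdim}(G)$ is the infimum of all $d \in \mathbb{N} = \{0,1,2,\ldots\}$ such that for all $r$ there exists $m$ such that $X_{d+1,r,m}$ contains a periodic point (it is $\infty$ if no such $d$ exists). It does not depend on the choice of finite generating set. *)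

theory Defs
  imports "HOL-Algebra.Algebra" "HOL-Library.Extended_Nat"
begin

section \<open>Restricted wreath products and the lamplighter group\<close>

definition semidirect_product ::
  "('a, 'm) monoid_scheme \<Rightarrow> ('b, 'n) monoid_scheme \<Rightarrow> ('b \<Rightarrow> 'a \<Rightarrow> 'a) \<Rightarrow> ('a \<times> 'b) monoid"
  where "semidirect_product N H \<phi> =
    \<lparr>carrier = carrier N \<times> carrier H,
     monoid.mult = (\<lambda>(f, s) (g, t). (f \<otimes>\<^bsub>N\<^esub> \<phi> s g, s \<otimes>\<^bsub>H\<^esub> t)),
     one = (\<one>\<^bsub>N\<^esub>, \<one>\<^bsub>H\<^esub>)\<rparr>"

definition left_shift :: "('a, 'm) monoid_scheme \<Rightarrow> 'a \<Rightarrow> ('a \<Rightarrow> 'b) \<Rightarrow> ('a \<Rightarrow> 'b)"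
  where "left_shift G g x = (\<lambda>h\<in>carrier G. x (inv\<^bsub>G\<^esub> g \<otimes>\<^bsub>G\<^esub> h))"

definition restricted_wreath ::
  "('a, 'm) monoid_scheme \<Rightarrow> ('b, 'n) monoid_scheme \<Rightarrow> (('b \<Rightarrow> 'a) \<times> 'b) monoid"
  where "restricted_wreath A H =
    semidirect_product (sum_group (carrier H) (\<lambda>_. A)) H (left_shift H)"

definition lamplighter :: "((int \<Rightarrow> int) \<times> int) monoid"
  where "lamplighter = restricted_wreath (integer_mod_group 2) integer_group"


section \<open>Word norm\<close>

definition fin_sym_generating :: "('a, 'm) monoid_scheme \<Rightarrow> 'a set \<Rightarrow> bool"
  where "fin_sym_generating G S \<longleftrightarrow>
    finite S \<and> S \<subseteq> carrier G \<and> (\<forall>s\<in>S. inv\<^bsub>G\<^esub> s \<in> S) \<and> generate G S = carrier G"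

definition word_norm :: "('a, 'm) monoid_scheme \<Rightarrow> 'a set \<Rightarrow> 'a \<Rightarrow> nat"
  where "word_norm G S g =
    (LEAST k. \<exists>ws. set ws \<subseteq> S \<and> length ws = k \<and> foldr (\<otimes>\<^bsub>G\<^esub>) ws \<one>\<^bsub>G\<^esub> = g)"


section \<open>Periodic asymptotic dimension\<close>

definition configurations :: "('a, 'm) monoid_scheme \<Rightarrow> nat \<Rightarrow> ('a \<Rightarrow> nat) set"
  where "configurations G n = carrier G \<rightarrow>\<^sub>E {1..n}"

definition periodic :: "('a, 'm) monoid_scheme \<Rightarrow> ('a \<Rightarrow> 'b) \<Rightarrow> bool"
  where "periodic G x \<longleftrightarrow> finite (rcosets\<^bsub>G\<^esub> (stabilizer G (left_shift G) x))"

definition color_edges ::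
  "('a, 'm) monoid_scheme \<Rightarrow> 'a set \<Rightarrow> nat \<Rightarrow> ('a \<Rightarrow> nat) \<Rightarrow> nat \<Rightarrow> ('a \<times> 'a) set"
  where "color_edges G S r x c =
    {(a, b). a \<in> carrier G \<and> b \<in> carrier G \<and> x a = c \<and> x b = c \<and>
             word_norm G S (inv\<^bsub>G\<^esub> a \<otimes>\<^bsub>G\<^esub> b) \<le> r}"

text \<open>The edge relation is symmetric for symmetric \<open>S\<close>, so the image of \<open>{a}\<close> under its
  reflexive transitive closure is the connected component of \<open>a\<close>. Finiteness has to be required
  separately because \<^const>\<open>card\<close> is 0 on infinite sets.\<close>

definition bounded_colorings ::
  "('a, 'm) monoid_scheme \<Rightarrow> 'a set \<Rightarrow> nat \<Rightarrow> nat \<Rightarrow> nat \<Rightarrow> ('a \<Rightarrow> nat) set"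
  where "bounded_colorings G S n r m =
    {x \<in> configurations G n. \<forall>c\<in>{1..n}. \<forall>a\<in>carrier G. x a = c \<longrightarrow>
       finite ((color_edges G S r x c)\<^sup>* `` {a}) \<and> card ((color_edges G S r x c)\<^sup>* `` {a}) \<le> m}"

text \<open>In \<^typ>\<open>enat\<close> the infimum of the empty set is \<open>\<infinity>\<close>.\<close>

definition pdim :: "('a, 'm) monoid_scheme \<Rightarrow> 'a set \<Rightarrow> enat"
  where "pdim G S =
    Inf {enat d | d. \<forall>r. \<exists>m. \<exists>x \<in> bounded_colorings G S (d + 1) r m. periodic G x}"


section \<open>The lamplighter group is a finitely generated group\<close>

lemma carrier_lamplighter:
  "carrier lamplighter = {f. (\<forall>i. f i \<in> {0, 1}) \<and> finite {i. f i \<noteq> 0}} \<times> UNIV"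
proof -
  have "{0..<2::int} = {0, 1}" by auto
  then show ?thesis
    by (auto simp: lamplighter_def restricted_wreath_def semidirect_product_def carrier_sum_group
        carrier_integer_mod_group PiE_def Pi_def)
qed

lemma one_lamplighter: "\<one>\<^bsub>lamplighter\<^esub> = (\<lambda>i. 0, 0)"
  by (simp add: lamplighter_def restricted_wreath_def semidirect_product_def restrict_def)

lemma mult_lamplighter:
  "(f, s) \<otimes>\<^bsub>lamplighter\<^esub> (g, t) = (\<lambda>i. (f i + g (i - s)) mod 2, s + t)"
  by (simp add: lamplighter_def restricted_wreath_def semidirect_product_def left_shift_def restrict_def)

lemma group_lamplighter: "group lamplighter"
proof (rule groupI)
  fix x y assume "x \<in> carrier lamplighter" "y \<in> carrier lamplighter"
  then obtain f s g t where xy: "x = (f, s)" "y = (g, t)"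
    and f: "\<And>i. f i \<in> {0, 1}" "finite {i. f i \<noteq> 0}" and g: "finite {i. g i \<noteq> 0}"
    by (auto simp: carrier_lamplighter)
  have "{i. (f i + g (i - s)) mod 2 \<noteq> 0} \<subseteq> {i. f i \<noteq> 0} \<union> (\<lambda>i. i + s) ` {i. g i \<noteq> 0}"
  proof
    fix i assume "i \<in> {i. (f i + g (i - s)) mod 2 \<noteq> 0}"
    then have "f i \<noteq> 0 \<or> g (i - s) \<noteq> 0" by auto
    moreover have "i = (i - s) + s" by simp
    ultimately show "i \<in> {i. f i \<noteq> 0} \<union> (\<lambda>i. i + s) ` {i. g i \<noteq> 0}" by blast
  qed
  then have "finite {i. (f i + g (i - s)) mod 2 \<noteq> 0}"
    using f g by (meson finite_UnI finite_imageI finite_subset)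
  then show "x \<otimes>\<^bsub>lamplighter\<^esub> y \<in> carrier lamplighter"
    by (auto simp: xy mult_lamplighter carrier_lamplighter)
next
  show "\<one>\<^bsub>lamplighter\<^esub> \<in> carrier lamplighter"
    by (simp add: one_lamplighter carrier_lamplighter)
next
  fix x y z :: "(int \<Rightarrow> int) \<times> int"
  show "x \<otimes>\<^bsub>lamplighter\<^esub> y \<otimes>\<^bsub>lamplighter\<^esub> z = x \<otimes>\<^bsub>lamplighter\<^esub> (y \<otimes>\<^bsub>lamplighter\<^esub> z)"
    by (cases x; cases y; cases z)
      (auto simp: mult_lamplighter mod_simps algebra_simps)
next
  fix x assume "x \<in> carrier lamplighter"
  then obtain f s where x: "x = (f, s)" and f: "\<And>i. f i \<in> {0, 1}" by (auto simp: carrier_lamplighter)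
  have "f i mod 2 = f i" for i using f[of i] by auto
  then show "\<one>\<^bsub>lamplighter\<^esub> \<otimes>\<^bsub>lamplighter\<^esub> x = x"
    by (auto simp: x mult_lamplighter one_lamplighter)
next
  fix x assume "x \<in> carrier lamplighter"
  then obtain f s where x: "x = (f, s)" and f: "\<And>i. f i \<in> {0, 1}" "finite {i. f i \<noteq> 0}"
    by (auto simp: carrier_lamplighter)
  let ?g = "\<lambda>i. f (i + s)"
  have "{i. ?g i \<noteq> 0} \<subseteq> (\<lambda>i. i - s) ` {i. f i \<noteq> 0}"
    by (auto intro!: image_eqI[where x = "_ + s"])
  then have "finite {i. ?g i \<noteq> 0}" using f(2) by (meson finite_imageI finite_subset)
  then have "(?g, - s) \<in> carrier lamplighter" using f by (auto simp: carrier_lamplighter)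
  moreover have "(?g i + f (i + s)) mod 2 = 0" for i using f(1)[of "i + s"] by auto
  then have "(?g, - s) \<otimes>\<^bsub>lamplighter\<^esub> x = \<one>\<^bsub>lamplighter\<^esub>"
    by (simp add: x mult_lamplighter one_lamplighter)
  ultimately show "\<exists>y\<in>carrier lamplighter. y \<otimes>\<^bsub>lamplighter\<^esub> x = \<one>\<^bsub>lamplighter\<^esub>" by blast
qed

lemma lamplighter_finitely_generated: "\<exists>S. fin_sym_generating lamplighter S"
proof -
  interpret L: group lamplighter by (rule group_lamplighter)
  define \<delta> :: "int \<Rightarrow> int \<Rightarrow> int" where "\<delta> n = (\<lambda>i. if i = n then 1 else 0)" for n
  define z :: "int \<Rightarrow> int" where "z = (\<lambda>i. 0)"
  define S :: "((int \<Rightarrow> int) \<times> int) set" where "S = {(\<delta> 0, 0), (z, 1), (z, - 1)}"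
  have S: "S \<subseteq> carrier lamplighter"
    by (auto simp: S_def z_def \<delta>_def carrier_lamplighter)
  have sym: "inv\<^bsub>lamplighter\<^esub> s \<in> S" if "s \<in> S" for s
  proof -
    have "inv\<^bsub>lamplighter\<^esub> (\<delta> 0, 0) = (\<delta> 0, 0)" "inv\<^bsub>lamplighter\<^esub> (z, 1) = (z, - 1)"
      "inv\<^bsub>lamplighter\<^esub> (z, - 1) = (z, 1)"
      using S by (auto intro!: L.inv_equality
          simp: S_def mult_lamplighter one_lamplighter z_def \<delta>_def)
    then show ?thesis using that by (auto simp: S_def)
  qed
  let ?T = "generate lamplighter S"
  have mult: "x \<otimes>\<^bsub>lamplighter\<^esub> y \<in> ?T" if "x \<in> ?T" "y \<in> ?T" for x y
    using that by (rule generate.eng)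
  have gen: "(\<delta> 0, 0) \<in> ?T" "(z, 1) \<in> ?T" "(z, - 1) \<in> ?T"
    by (auto intro: generate.incl simp: S_def)
  have shift: "(z, n) \<in> ?T" for n
  proof (induction n rule: int_induct[where k = 0])
    case base
    show ?case using generate.one[of lamplighter S] by (simp add: one_lamplighter z_def)
  next
    case (step1 i)
    then show ?case using mult[OF step1(2) gen(2)] by (simp add: mult_lamplighter z_def)
  next
    case (step2 i)
    then show ?case using mult[OF step2(2) gen(3)] by (simp add: mult_lamplighter z_def)
  qed
  have lamp: "(\<delta> n, 0) \<in> ?T" for n
  proof -
    have "(z, n) \<otimes>\<^bsub>lamplighter\<^esub> (\<delta> 0, 0) \<otimes>\<^bsub>lamplighter\<^esub> (z, - n) = (\<delta> n, 0)"
      by (auto simp: mult_lamplighter z_def \<delta>_def)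
    then show ?thesis using mult[OF mult[OF shift[of n] gen(1)] shift[of "- n"]] by simp
  qed
  have lamps: "(\<lambda>i. if i \<in> A then 1 else 0, 0) \<in> ?T" if "finite A" for A :: "int set"
    using that
  proof induction
    case empty
    then show ?case using shift[of 0] by (simp add: z_def)
  next
    case (insert n A)
    have "(\<delta> n, 0) \<otimes>\<^bsub>lamplighter\<^esub> (\<lambda>i. if i \<in> A then 1 else 0, 0)
        = (\<lambda>i. if i \<in> insert n A then 1 else 0, 0)"
      using insert by (auto simp: mult_lamplighter \<delta>_def)
    then show ?case using mult[OF lamp[of n] insert.IH] by simp
  qed
  have "x \<in> ?T" if "x \<in> carrier lamplighter" for x
  proof -
    obtain f s where x: "x = (f, s)" and f: "\<And>i. f i \<in> {0, 1}" "finite {i. f i \<noteq> 0}"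
      using \<open>x \<in> carrier lamplighter\<close> by (cases x) (auto simp: carrier_lamplighter)
    have "f i = (if i \<in> {i. f i \<noteq> 0} then 1 else 0)" for i using f(1)[of i] by auto
    then have "f = (\<lambda>i. if i \<in> {i. f i \<noteq> 0} then 1 else 0)" by (rule ext)
    then have "(f, 0) \<in> ?T" using lamps[OF f(2)] by simp
    moreover have "f i mod 2 = f i" for i using f(1)[of i] by auto
    then have "(f, 0) \<otimes>\<^bsub>lamplighter\<^esub> (z, s) = x"
      by (simp add: x mult_lamplighter z_def)
    ultimately show ?thesis using mult[OF _ shift[of s]] by metis
  qed
  then have "?T = carrier lamplighter" using L.generate_incl[OF S] by blast
  moreover have "finite S" by (simp add: S_def)
  ultimately show ?thesis using S sym unfolding fin_sym_generating_def by blast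
qed

end

theory Submission
  imports Defs
begin

text \<open>The lamp group is locally finite, so it suffices to colour by the position \<open>s\<close> of the lamplighter
  alone: split \<open>\<int>\<close> into intervals of length \<open>L\<close>, larger than any displacement by a word of norm at
  most \<open>r\<close>, and colour them alternately. A path of one colour cannot leave its interval and switches
  only lamps near it, so components are bounded; the colour depends on \<open>s\<close> modulo \<open>2 L\<close>,
  so the colouring is periodic. A single colour does not suffice because the Cayley graph of an infinite
  group is an infinite component.\<close>

section \<open>Words in a symmetric generating set\<close>

lemma (in group) foldr_mult_closed:
  assumes "set ws \<subseteq> carrier G"
  shows "foldr (\<otimes>) ws \<one> \<in> carrier G"
  using assms by (induction ws) auto

lemma (in group) foldr_mult_append:
  assumes "set us \<subseteq> carrier G" "set ws \<subseteq> carrier G"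
  shows "foldr (\<otimes>) (us @ ws) \<one> = foldr (\<otimes>) us \<one> \<otimes> foldr (\<otimes>) ws \<one>"
  using assms by (induction us) (auto simp: foldr_mult_closed m_assoc)

text \<open>Words use letters of \<open>S\<close> only. Symmetry of \<open>S\<close> turns the
  \<open>inv\<close> case of \<open>generate\<close> into a one-letter word, and products become
  concatenations.\<close>

lemma (in group) generating_word:
  assumes "fin_sym_generating G S" "g \<in> carrier G"
  obtains ws where "set ws \<subseteq> S" "foldr (\<otimes>) ws \<one> = g"
proof -
  have S: "S \<subseteq> carrier G" and inv: "\<And>s. s \<in> S \<Longrightarrow> inv s \<in> S" and "g \<in> generate G S"
    using assms by (auto simp: fin_sym_generating_def)
  from this(3) have "\<exists>ws. set ws \<subseteq> S \<and> foldr (\<otimes>) ws \<one> = g"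
  proof induction
    case one
    show ?case by (intro exI[of _ "[]"]) simp
  next
    case (incl s)
    then show ?case using S by (intro exI[of _ "[s]"]) auto
  next
    case (inv s)
    then show ?case using S \<open>\<And>s. s \<in> S \<Longrightarrow> inv s \<in> S\<close> by (intro exI[of _ "[inv s]"]) auto
  next
    case (eng g h)
    then obtain us ws where "set us \<subseteq> S" "foldr (\<otimes>) us \<one> = g" "set ws \<subseteq> S" "foldr (\<otimes>) ws \<one> = h"
      by blast
    then show ?case using S by (intro exI[of _ "us @ ws"]) (auto simp del: foldr_append simp: foldr_mult_append)
  qed
  then show ?thesis using that by blast
qed

lemma (in group) word_norm_le_1:
  assumes "S \<subseteq> carrier G" "s \<in> S"
  shows "word_norm G S s \<le> 1"
  unfolding word_norm_def using assms by (intro Least_le exI[of _ "[s]"]) auto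

lemma (in group) finite_word_norm_ball:
  assumes "fin_sym_generating G S"
  shows "finite {g \<in> carrier G. word_norm G S g \<le> r}"
proof -
  let ?W = "{ws. set ws \<subseteq> S \<and> length ws \<le> r}"
  have "{g \<in> carrier G. word_norm G S g \<le> r} \<subseteq> (\<lambda>ws. foldr (\<otimes>) ws \<one>) ` ?W"
  proof
    fix g assume g: "g \<in> {g \<in> carrier G. word_norm G S g \<le> r}"
    let ?P = "\<lambda>k. \<exists>ws. set ws \<subseteq> S \<and> length ws = k \<and> foldr (\<otimes>) ws \<one> = g"
    obtain ws where "set ws \<subseteq> S" "foldr (\<otimes>) ws \<one> = g"
      using generating_word[OF assms] g by blast
    \<comment> \<open>\<open>LEAST\<close> carries information only once some length is known to be
      attained. Generation provides one, so the norm itself is the length of a word for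
      \<open>g\<close>.\<close>
    then have "?P (length ws)" by blast
    then have "?P (word_norm G S g)" unfolding word_norm_def by (rule LeastI)
    then show "g \<in> (\<lambda>ws. foldr (\<otimes>) ws \<one>) ` ?W" using g by auto
  qed
  moreover have "finite ?W"
    using assms finite_lists_length_le by (auto simp: fin_sym_generating_def)
  ultimately show ?thesis using finite_surj by blast
qed

text \<open>It suffices to exclude \<open>d = 0\<close>, where a single colour is available and the
  edges for \<open>r = 1\<close> contain the connected Cayley graph.\<close>

lemma (in group) pdim_ge_1:
  assumes gen: "fin_sym_generating G S" and inf: "infinite (carrier G)"
  shows "1 \<le> pdim G S"
  unfolding pdim_def
proof (intro Inf_greatest, clarify)
  fix d assume d: "\<forall>r. \<exists>m. \<exists>x \<in> bounded_colorings G S (d + 1) r m. periodic G x"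
  have S: "S \<subseteq> carrier G" using gen by (simp add: fin_sym_generating_def)
  have "d \<noteq> 0"
  proof
    assume "d = 0"
    with d obtain m x where x: "x \<in> bounded_colorings G S 1 1 m" by fastforce
    have x1: "x a = 1" if "a \<in> carrier G" for a
      using x that by (auto simp: bounded_colorings_def configurations_def dest: PiE_mem)
    let ?E = "color_edges G S 1 x 1"
    \<comment> \<open>Edges are measured by \<open>inv a \<otimes> b\<close>, so right
      multiplication by a letter is an edge at every vertex, and a word spells a path.\<close>
    have path: "(a, a \<otimes> foldr (\<otimes>) ws \<one>) \<in> ?E\<^sup>*" if "set ws \<subseteq> S" "a \<in> carrier G" for ws a
      using that
    proof (induction ws arbitrary: a)
      case (Cons s ws)
      then have s: "s \<in> carrier G" and ws: "set ws \<subseteq> carrier G" using S by auto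
      have "inv a \<otimes> (a \<otimes> s) = s" using s Cons.prems(2) by (simp flip: m_assoc)
      then have "(a, a \<otimes> s) \<in> ?E"
        using s Cons.prems word_norm_le_1[OF S, of s] by (simp add: color_edges_def x1)
      moreover have "(a \<otimes> s, a \<otimes> s \<otimes> foldr (\<otimes>) ws \<one>) \<in> ?E\<^sup>*"
        using Cons s by simp
      ultimately show ?case
        using s Cons.prems(2) foldr_mult_closed[OF ws] by (simp add: m_assoc)
    qed simp
    have "carrier G \<subseteq> ?E\<^sup>* `` {\<one>}"
    proof
      fix g assume g: "g \<in> carrier G"
      obtain ws where "set ws \<subseteq> S" "foldr (\<otimes>) ws \<one> = g" using generating_word[OF gen g] .
      then show "g \<in> ?E\<^sup>* `` {\<one>}" using path[of ws \<one>] g by simp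
    qed
    moreover have "finite (?E\<^sup>* `` {\<one>})"
      using x x1[of \<one>] by (auto simp: bounded_colorings_def)
    ultimately show False using inf finite_subset by blast
  qed
  then show "1 \<le> enat d" by (simp add: one_enat_def)
qed

section \<open>Periodicity\<close>

lemma (in group) left_shift_mult:
  assumes "g \<in> carrier G" "h \<in> carrier G"
  shows "left_shift G (g \<otimes> h) x = left_shift G g (left_shift G h x)"
  using assms by (auto simp: left_shift_def inv_mult_group m_assoc)

text \<open>\<open>left_shift\<close> returns functions restricted to the carrier, hence the
  identity can fix only extensional ones.\<close>

lemma (in group) left_shift_one:
  assumes "x \<in> extensional (carrier G)"
  shows "left_shift G \<one> x = x"
  using assms by (auto simp: left_shift_def extensional_def)

lemma (in group) subgroup_stabilizer_left_shift:
  assumes "x \<in> extensional (carrier G)"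
  shows "subgroup (stabilizer G (left_shift G) x) G"
proof (rule subgroupI)
  show "stabilizer G (left_shift G) x \<noteq> {}"
    using left_shift_one[OF assms] by (auto simp: stabilizer_def)
next
  fix g assume "g \<in> stabilizer G (left_shift G) x"
  then have g: "g \<in> carrier G" "left_shift G g x = x" by (auto simp: stabilizer_def)
  then have "left_shift G (inv g) x = left_shift G (inv g \<otimes> g) x"
    by (simp only: left_shift_mult inv_closed)
  then show "inv g \<in> stabilizer G (left_shift G) x"
    using g left_shift_one[OF assms] by (simp add: stabilizer_def)
qed (auto simp: stabilizer_def left_shift_mult)

text \<open>Each fibre of \<open>p\<close> lies in one right coset of the stabilizer, so there are
  at most as many cosets as values of \<open>p\<close>.\<close>

lemma (in group) periodic_if_finite_invariant:
  assumes x: "x \<in> extensional (carrier G)" and fin: "finite (p ` carrier G)"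
    and stab: "\<And>a b. \<lbrakk>a \<in> carrier G; b \<in> carrier G; p a = p b\<rbrakk> \<Longrightarrow> left_shift G (a \<otimes> inv b) x = x"
  shows "periodic G x"
proof -
  let ?K = "stabilizer G (left_shift G) x"
  note K = subgroup_stabilizer_left_shift[OF x]
  have coset_eq: "?K #> a = ?K #> b" if "a \<in> carrier G" "b \<in> carrier G" "p a = p b" for a b
  proof (rule coset_mult_inv1)
    have "a \<otimes> inv b \<in> ?K" using stab that by (simp add: stabilizer_def)
    then show "?K #> (a \<otimes> inv b) = ?K" using K that by (intro coset_join2) auto
  qed (use that subgroup.subset[OF K] in auto)
  have "rcosets ?K \<subseteq> (\<lambda>v. ?K #> (SOME a. a \<in> carrier G \<and> p a = v)) ` p ` carrier G"
  proof
    fix C assume "C \<in> rcosets ?K"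
    then obtain a where a: "a \<in> carrier G" "C = ?K #> a" by (auto simp: RCOSETS_def)
    have "(SOME b. b \<in> carrier G \<and> p b = p a) \<in> carrier G \<and> p (SOME b. b \<in> carrier G \<and> p b = p a) = p a"
      using a(1) by (intro someI[of "\<lambda>b. b \<in> carrier G \<and> p b = p a"]) simp
    then show "C \<in> (\<lambda>v. ?K #> (SOME a. a \<in> carrier G \<and> p a = v)) ` p ` carrier G"
      using a coset_eq by blast
  qed
  then show ?thesis unfolding periodic_def using fin finite_subset by blast
qed

section \<open>The lamplighter group\<close>

lemma snd_mult_lamplighter: "snd (a \<otimes>\<^bsub>lamplighter\<^esub> b) = snd a + snd b"
  by (cases a; cases b) (simp add: mult_lamplighter)

lemma snd_inv_lamplighter:
  assumes "a \<in> carrier lamplighter"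
  shows "snd (inv\<^bsub>lamplighter\<^esub> a) = - snd a"
proof -
  interpret L: group lamplighter by (rule group_lamplighter)
  have "snd (a \<otimes>\<^bsub>lamplighter\<^esub> inv\<^bsub>lamplighter\<^esub> a) = 0"
    using assms by (simp add: one_lamplighter)
  then show ?thesis by (simp add: snd_mult_lamplighter)
qed

lemma infinite_carrier_lamplighter: "infinite (carrier lamplighter)"
proof
  assume "finite (carrier lamplighter)"
  then have "finite (snd ` carrier lamplighter)" by simp
  moreover have "snd ` carrier lamplighter = UNIV"
    by (auto simp: carrier_lamplighter image_iff intro!: exI[of _ "\<lambda>_. 0"])
  ultimately show False by (simp add: infinite_UNIV_int)
qed

text \<open>For the ball of radius \<open>r\<close>, one \<open>R\<close> controls both how far the
  lamplighter moves and how far away lamps are switched. Supports are finite, so only finitely many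
  integers occur.\<close>

lemma finite_set_lamplighter_bound:
  assumes "finite B" "B \<subseteq> carrier lamplighter"
  obtains R where "\<And>f s. (f, s) \<in> B \<Longrightarrow> \<bar>s\<bar> \<le> R" "\<And>f s i. (f, s) \<in> B \<Longrightarrow> f i \<noteq> 0 \<Longrightarrow> \<bar>i\<bar> \<le> R" "0 \<le> R"
proof -
  \<comment> \<open>Inserting 0 makes the maximum well defined even for empty \<open>B\<close>, and
    makes it nonnegative.\<close>
  define I where "I = insert 0 (snd ` B \<union> (\<Union>(f, s)\<in>B. {i. f i \<noteq> 0}))"
  have "finite I" using assms by (auto simp: I_def carrier_lamplighter)
  then have bound: "\<bar>i\<bar> \<le> Max (abs ` I)" if "i \<in> I" for i using that by simp
  show ?thesis
  proof (rule that)
    show "\<bar>s\<bar> \<le> Max (abs ` I)" if "(f, s) \<in> B" for f s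
    proof (rule bound)
      have "s \<in> snd ` B" using that by (rule rev_image_eqI) simp
      then show "s \<in> I" by (simp add: I_def)
    qed
    show "\<bar>i\<bar> \<le> Max (abs ` I)" if "(f, s) \<in> B" "f i \<noteq> 0" for f s i
    proof (rule bound)
      have "i \<in> (\<Union>(f, s)\<in>B. {i. f i \<noteq> 0})" using that by blast
      then show "i \<in> I" by (simp add: I_def)
    qed
    show "0 \<le> Max (abs ` I)" using bound[of 0] by (simp add: I_def)
  qed
qed

text \<open>A displacement below \<open>L\<close> changes the interval index by at most 1, and equal
  parity rules out a change by exactly 1.\<close>

lemma div_eq_if_close_same_parity:
  fixes s t L :: int
  assumes "\<bar>t - s\<bar> < L" "(s div L) mod 2 = (t div L) mod 2"
  shows "s div L = t div L"
proof -
  have L: "0 < L" using assms(1) by linarith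
  have "t div L \<le> (s + L) div L" "s div L \<le> (t + L) div L"
    using assms(1) L by (intro zdiv_mono1; linarith)+
  then have "t div L \<le> s div L + 1" "s div L \<le> t div L + 1" using L by simp_all
  moreover have "p = q" if "p mod 2 = q mod 2" "q \<le> p + 1" "p \<le> q + 1" for p q :: int
    using that by presburger
  ultimately show ?thesis using assms(2) by blast
qed

lemma close_if_div_eq:
  fixes s t L :: int
  assumes "0 < L" "s div L = t div L"
  shows "\<bar>t - s\<bar> < L"
proof -
  have "L * (s div L) + s mod L = s" "L * (t div L) + t mod L = t" by simp_all
  moreover have "L * (s div L) = L * (t div L)" using assms(2) by simp
  moreover have "0 \<le> s mod L" "s mod L < L" "0 \<le> t mod L" "t mod L < L" using assms(1) by simp_all
  ultimately show ?thesis by linarith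
qed

text \<open>Adding 1 puts the parities into the colour set \<open>{1..2}\<close>; the restriction
  makes the colouring extensional, as \<open>configurations\<close> demands.\<close>

definition interval_coloring :: "int \<Rightarrow> (int \<Rightarrow> int) \<times> int \<Rightarrow> nat"
  where "interval_coloring L = (\<lambda>a\<in>carrier lamplighter. 1 + nat ((snd a div L) mod 2))"

lemma periodic_interval_coloring:
  assumes "0 < L"
  shows "periodic lamplighter (interval_coloring L)"
proof -
  interpret L: group lamplighter by (rule group_lamplighter)
  show ?thesis
  proof (rule L.periodic_if_finite_invariant)
    show "interval_coloring L \<in> extensional (carrier lamplighter)"
      by (simp add: interval_coloring_def)
    have "(\<lambda>a. snd a mod (2 * L)) ` carrier lamplighter \<subseteq> {0..<2 * L}" using assms by auto
    then show "finite ((\<lambda>a. snd a mod (2 * L)) ` carrier lamplighter)"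
      using finite_subset by blast
    fix a b assume ab: "a \<in> carrier lamplighter" "b \<in> carrier lamplighter"
      and "snd a mod (2 * L) = snd b mod (2 * L)"
    then have "2 * L dvd snd a - snd b" by (simp add: mod_eq_dvd_iff)
    then obtain k where k: "snd a - snd b = 2 * L * k" by (auto simp: dvd_def)
    let ?g = "a \<otimes>\<^bsub>lamplighter\<^esub> inv\<^bsub>lamplighter\<^esub> b"
    \<comment> \<open>Shifting by \<open>?g\<close> moves positions by a multiple of
      \<open>2 * L\<close>, that is, by an even number of intervals, which preserves the parity of
      the index.\<close>
    have "((snd (inv\<^bsub>lamplighter\<^esub> ?g \<otimes>\<^bsub>lamplighter\<^esub> h)) div L) mod 2 = (snd h div L) mod 2" for h
    proof -
      have "snd (inv\<^bsub>lamplighter\<^esub> ?g \<otimes>\<^bsub>lamplighter\<^esub> h) = snd h + (- 2 * k) * L"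
        using ab k by (simp add: snd_mult_lamplighter snd_inv_lamplighter algebra_simps)
      moreover have "(snd h + (- 2 * k) * L) div L = - 2 * k + snd h div L"
        using assms by (intro div_mult_self1) simp
      moreover have "(- 2 * k + n) mod 2 = n mod 2" for n :: int
        by presburger
      ultimately show ?thesis by (simp only:)
    qed
    then show "left_shift lamplighter ?g (interval_coloring L) = interval_coloring L"
      using ab unfolding left_shift_def interval_coloring_def
      by (intro restrict_ext) (simp only: restrict_apply' L.m_closed L.inv_closed)
  qed
qed

lemma interval_coloring_bounded:
  assumes gen: "fin_sym_generating lamplighter S"
  obtains L m where "0 < L" "interval_coloring L \<in> bounded_colorings lamplighter S 2 r m"
proof -
  interpret L: group lamplighter by (rule group_lamplighter)
  define B where "B = {g \<in> carrier lamplighter. word_norm lamplighter S g \<le> r}"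
  obtain R where R_pos: "\<And>f s. (f, s) \<in> B \<Longrightarrow> \<bar>s\<bar> \<le> R"
    and R_lamp: "\<And>f s i. (f, s) \<in> B \<Longrightarrow> f i \<noteq> 0 \<Longrightarrow> \<bar>i\<bar> \<le> R" and R: "0 \<le> R"
    by (rule finite_set_lamplighter_bound[of B]) (auto simp: B_def L.finite_word_norm_ball[OF gen])
  \<comment> \<open>The extra 1 gives the strict inequality that
    \<open>div_eq_if_close_same_parity\<close> needs.\<close>
  define L where "L = R + 1"
  have L: "0 < L" using R by (simp add: L_def)
  define x where "x = interval_coloring L"
  \<comment> \<open>A lamplighter confined to the interval of \<open>s\<close> stays within
    \<open>L\<close> of \<open>s\<close> and reaches lamps at distance at most \<open>R\<close>, so
    \<open>J s\<close> contains every lamp that can change.\<close>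
  define J where "J s = {s - (L + R)..s + (L + R)}" for s
  \<comment> \<open>The number of lamp patterns on \<open>J s\<close> times the number of positions
    in \<open>{s - L..s + L}\<close>.\<close>
  define m where "m = 2 ^ nat (2 * (L + R) + 1) * nat (2 * L + 1)"
  have comp: "finite ((color_edges lamplighter S r x c)\<^sup>* `` {a})
      \<and> card ((color_edges lamplighter S r x c)\<^sup>* `` {a}) \<le> m"
    if a_carrier: "a \<in> carrier lamplighter" for c a
  proof -
    obtain f s where a: "a = (f, s)" by (cases a)
    let ?C = "(color_edges lamplighter S r x c)\<^sup>* `` {a}"
    have inv: "b \<in> carrier lamplighter \<and> snd b div L = s div L \<and> (\<forall>i. i \<notin> J s \<longrightarrow> fst b i = f i)"
      if "(a, b) \<in> (color_edges lamplighter S r x c)\<^sup>*" for b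
      using that
    proof induction
      case base
      then show ?case using a_carrier by (simp add: a)
    next
      case (step b b')
      then have b: "b \<in> carrier lamplighter" "b' \<in> carrier lamplighter" and col: "x b = x b'"
        and w: "word_norm lamplighter S (inv\<^bsub>lamplighter\<^esub> b \<otimes>\<^bsub>lamplighter\<^esub> b') \<le> r"
        by (auto simp: color_edges_def)
      obtain h u where hu: "inv\<^bsub>lamplighter\<^esub> b \<otimes>\<^bsub>lamplighter\<^esub> b' = (h, u)" by fastforce
      obtain g t where gt: "b = (g, t)" by fastforce
      have huB: "(h, u) \<in> B" using w b by (simp add: B_def flip: hu)
      have "b' = b \<otimes>\<^bsub>lamplighter\<^esub> (h, u)" using b by (simp flip: hu L.m_assoc)
      \<comment> \<open>One edge displaces the position by \<open>u\<close> and adds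
        \<open>h\<close> translated to \<open>t\<close>, so it switches only lamps within
        \<open>R\<close> of \<open>t\<close>.\<close>
      then have b': "b' = (\<lambda>i. (g i + h (i - t)) mod 2, t + u)" by (simp add: gt mult_lamplighter)
      have "(t div L) mod 2 = ((t + u) div L) mod 2"
        using col b by (simp add: x_def interval_coloring_def gt b' nat_eq_iff)
      moreover have "\<bar>t + u - t\<bar> < L" using R_pos[OF huB] by (simp add: L_def)
      ultimately have "t div L = (t + u) div L" by (intro div_eq_if_close_same_parity)
      moreover have ts: "s div L = t div L" using step.IH by (simp add: gt)
      moreover have "(g i + h (i - t)) mod 2 = f i" if "i \<notin> J s" for i
      proof -
        have "\<bar>t - s\<bar> < L" using close_if_div_eq[OF L ts] .
        then have "\<not> \<bar>i - t\<bar> \<le> R" using that by (auto simp: J_def)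
        then have "h (i - t) = 0" using R_lamp[OF huB] by blast
        moreover have "g i = f i" using step.IH that by (simp add: gt)
        moreover have "g i \<in> {0, 1}" using b(1) by (simp add: gt carrier_lamplighter)
        ultimately show ?thesis by auto
      qed
      ultimately show ?case using b by (simp add: b')
    qed
    \<comment> \<open>\<open>?F\<close> rebuilds a vertex of the component from the set of lit lamps
      in \<open>J s\<close> and the position; all other lamps are as in \<open>f\<close>.\<close>
    let ?F = "\<lambda>(A, t). (\<lambda>i. if i \<in> J s then if i \<in> A then 1 else 0 else f i, t)"
    let ?D = "Pow (J s) \<times> {s - L..s + L}"
    have sub: "?C \<subseteq> ?F ` ?D"
    proof
      fix b assume "b \<in> ?C"
      moreover obtain g t where gt: "b = (g, t)" by fastforce
      ultimately have g: "\<And>i. g i \<in> {0, 1}" "\<And>i. i \<notin> J s \<Longrightarrow> g i = f i" and t: "s div L = t div L"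
        using inv[of b] by (auto simp: carrier_lamplighter)
      have "\<bar>t - s\<bar> < L" using close_if_div_eq[OF L t] .
      then have "({i \<in> J s. g i = 1}, t) \<in> ?D" by auto
      moreover have "b = ?F ({i \<in> J s. g i = 1}, t)"
        using g by (fastforce simp: gt)
      ultimately show "b \<in> ?F ` ?D" by (rule rev_image_eqI)
    qed
    have fin: "finite ?D" by (simp add: J_def)
    have "card ?C \<le> card (?F ` ?D)" using sub fin by (intro card_mono finite_imageI)
    also have "\<dots> \<le> card ?D" using fin by (rule card_image_le)
    also have "\<dots> = m"
      by (simp add: card_cartesian_product card_Pow J_def m_def algebra_simps)
    finally show ?thesis using finite_subset[OF sub finite_imageI[OF fin]] by blast
  qed
  moreover have "x \<in> configurations lamplighter 2"
  proof -
    have "nat (k mod 2) \<le> 1" for k :: int by linarith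
    then show ?thesis by (auto simp: configurations_def x_def interval_coloring_def)
  qed
  ultimately have "x \<in> bounded_colorings lamplighter S 2 r m" by (simp add: bounded_colorings_def)
  then show ?thesis using that L by (simp add: x_def)
qed

theorem corollary9p5:
  fixes S :: "((int \<Rightarrow> int) \<times> int) set"
  assumes "fin_sym_generating lamplighter S"
  shows "pdim lamplighter S = 1"
proof (rule antisym)
  \<comment> \<open>The number of colours is written \<open>1 + 1\<close> to match
    \<open>d + 1\<close> in \<open>pdim_def\<close> at \<open>d = 1\<close>.\<close>
  have "\<exists>m. \<exists>x \<in> bounded_colorings lamplighter S (1 + 1) r m. periodic lamplighter x" for r
  proof -
    obtain L m where "0 < L" "interval_coloring L \<in> bounded_colorings lamplighter S 2 r m"
      by (rule interval_coloring_bounded[OF assms])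
    then show ?thesis using periodic_interval_coloring unfolding one_add_one by blast
  qed
  then show "pdim lamplighter S \<le> 1"
    unfolding pdim_def one_enat_def by (intro Inf_lower) blast
  show "1 \<le> pdim lamplighter S"
    using group.pdim_ge_1[OF group_lamplighter assms infinite_carrier_lamplighter] .
qed

end
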